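(* Let $k>1$ be an integer, $\sigma$ a permutation of $\{0,1,\ldots,n\}$, and let $r=[a_0;a_1,\ldots,a_n]$ be a $(\sigma,k)$-permutiple. Let $p_n=K_{n+1}(a_0,\ldots,a_n)$ and $p'_n=K_{n+1}(a_{\sigma(0)},\ldots,a_{\sigma(n)})$. If $\frac{p_n}{p'_n}<2$, then $r$ is continuant-preserving, i.e. $p_n=p'_n$.
   Context: For positive integers $a_0,\ldots,a_n$, $[a_0;a_1,\ldots,a_n]$ denotes the finite simple continued fraction $a_0+1/(a_1+1/(\cdots+1/a_n))$; all finite continued fractions are assumed in canonical form (last digit at least $2$ when there are at least two digits). For an integer $k>1$ and a permutation $\sigma$ of $\{0,\ldots,n\}$, $r=[a_0;\ldots,a_n]$ is a $(\sigma,k)$-permutiple if $r=k\,[a_{\sigma(0)};a_{\sigma(1)},\ldots,a_{\sigma(n)}]$. Continuants: $K_0()=1$, $K_1(x_0)=x_0$, $K_m(x_0,\ldots,x_{m-1})=x_{m-1}K_{m-1}(x_0,\ldots,x_{m-2})+K_{m-2}(x_0,\ldots,x_{m-3})$. The permutiple is continuant-preserving if $K_{n+1}(a_0,\ldots,a_n)=K_{n+1}(a_{\sigma(0)},\ldots,a_{\sigma(n)})$. *)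

theory Defs
  imports Complex_Main "HOL-Combinatorics.Permutations"
begin

(* Digit sequences are functions on nat of which only the values at 0, ..., n matter. *)

text \<open>The value of $[x_0; x_1, \ldots, x_n]$.\<close>

fun cf_value :: "nat \<Rightarrow> (nat \<Rightarrow> int) \<Rightarrow> real" where
  "cf_value 0 x = of_int (x 0)"
| "cf_value (Suc n) x = of_int (x 0) + 1 / cf_value n (\<lambda>i. x (Suc i))"

text \<open>The continuant $K_m(x_0, \ldots, x_{m-1})$.\<close>

fun continuant :: "nat \<Rightarrow> (nat \<Rightarrow> int) \<Rightarrow> int" where
  "continuant 0 x = 1"
| "continuant (Suc 0) x = x 0"
| "continuant (Suc (Suc m)) x = x (Suc m) * continuant (Suc m) x + continuant m x"

definition canonical_cf :: "nat \<Rightarrow> (nat \<Rightarrow> int) \<Rightarrow> bool" where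
  "canonical_cf n x \<longleftrightarrow> (\<forall>i\<le>n. x i > 0) \<and> (n \<ge> 1 \<longrightarrow> x n \<ge> 2)"

text \<open>Canonical form is a standing convention for all finite continued fractions, so it is
  required of both expansions in the defining equation.\<close>

definition permutiple :: "nat \<Rightarrow> (nat \<Rightarrow> nat) \<Rightarrow> int \<Rightarrow> (nat \<Rightarrow> int) \<Rightarrow> bool" where
  "permutiple n \<sigma> k a \<longleftrightarrow>
     k > 1 \<and> \<sigma> permutes {0..n} \<and>
     canonical_cf n a \<and> canonical_cf n (a \<circ> \<sigma>) \<and>
     cf_value n a = of_int k * cf_value n (a \<circ> \<sigma>)"

definition continuant_preserving :: "nat \<Rightarrow> (nat \<Rightarrow> nat) \<Rightarrow> (nat \<Rightarrow> int) \<Rightarrow> bool" where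
  "continuant_preserving n \<sigma> a \<longleftrightarrow> continuant (n + 1) a = continuant (n + 1) (a \<circ> \<sigma>)"

end

theory Submission imports Defs
begin

text \<open>Write \<open>r = p / q\<close> and \<open>r / k = p' / q'\<close>, where the numerators are continuants and both
  fractions are in lowest terms. Then \<open>p q' = k p' q\<close>, so \<open>p'\<close> divides \<open>p q'\<close> and, being
  coprime to \<open>q'\<close>, divides \<open>p\<close>. Hence \<open>p / p'\<close> is a positive integer below 2.\<close>

text \<open>The defining recurrence splits off the last entry, whereas \<open>cf_value\<close>
  splits off the first; this mirrored recurrence connects the two.\<close>

lemma continuant_shift:
  "continuant (Suc (Suc m)) x =
     x 0 * continuant (Suc m) (\<lambda>i. x (Suc i)) + continuant m (\<lambda>i. x (Suc (Suc i)))"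
proof (induction m rule: induct_nat_012)
  case (ge2 m)
  have "continuant (Suc (Suc (Suc (Suc m)))) x =
      x (Suc (Suc (Suc m))) * continuant (Suc (Suc (Suc m))) x + continuant (Suc (Suc m)) x"
    by (rule continuant.simps)
  also have "\<dots> = x 0 * continuant (Suc (Suc (Suc m))) (\<lambda>i. x (Suc i)) +
      continuant (Suc (Suc m)) (\<lambda>i. x (Suc (Suc i)))"
    \<comment> \<open>Once both continuants of \<open>x\<close> are expanded at \<open>x 0\<close>,
      the coefficient of \<open>x 0\<close> and the remainder each recombine by the defining
      recurrence.\<close>
    unfolding ge2.IH by (simp add: algebra_simps)
  finally show ?case .
qed (simp_all add: algebra_simps)

lemma continuant_pos:
  assumes "\<And>i. i < m \<Longrightarrow> x i > 0"
  shows "continuant m x > 0"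
  using assms by (induction m x rule: continuant.induct) (auto intro!: add_pos_pos)

text \<open>One Euclidean step, subtracting \<open>x 0\<close> times the second continuant from the
  first, leaves the same pair for the shifted sequence, in swapped order.\<close>

lemma coprime_continuant_shift:
  "coprime (continuant (Suc n) x) (continuant n (\<lambda>i. x (Suc i)))"
proof (induction n arbitrary: x)
  case (Suc n)
  from Suc[of "\<lambda>i. x (Suc i)"] show ?case
    unfolding continuant_shift
    by (simp add: coprime_iff_gcd_eq_1 gcd_add_mult gcd.commute[of "_ + _"]
        gcd.commute[of "continuant n _"]
        del: continuant.simps)
qed simp

lemma cf_value_eq_continuant_quotient:
  assumes "\<And>i. i \<le> n \<Longrightarrow> x i > 0"
  shows "cf_value n x =
    of_int (continuant (Suc n) x) / of_int (continuant n (\<lambda>i. x (Suc i)))"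
  using assms
proof (induction n arbitrary: x)
  case (Suc n)
  have pos: "continuant (Suc n) (\<lambda>i. x (Suc i)) > 0"
    using Suc.prems by (intro continuant_pos) auto
  have "cf_value n (\<lambda>i. x (Suc i)) = of_int (continuant (Suc n) (\<lambda>i. x (Suc i))) /
      of_int (continuant n (\<lambda>i. x (Suc (Suc i))))"
    using Suc.prems by (intro Suc.IH) auto
  \<comment> \<open>Positivity allows \<open>x 0\<close> to be put over the tail's numerator, which
    becomes the new denominator.\<close>
  with pos show ?case
    unfolding continuant_shift by (simp add: add_divide_distrib del: continuant.simps)
qed simp

theorem theorem6:
  fixes n :: nat and \<sigma> :: "nat \<Rightarrow> nat" and k :: int and a :: "nat \<Rightarrow> int"
  assumes "k > 1"
    and "\<sigma> permutes {0..n}"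
    and "permutiple n \<sigma> k a"
    and "real_of_int (continuant (n + 1) a) / real_of_int (continuant (n + 1) (a \<circ> \<sigma>)) < 2"
  shows "continuant_preserving n \<sigma> a"
proof -
  define b where "b = a \<circ> \<sigma>"
  define p p' where "p = continuant (Suc n) a" and "p' = continuant (Suc n) b"
  \<comment> \<open>The denominators use the digits 1 to \<open>n\<close>; for \<open>n = 0\<close>
    they are the empty continuant 1.\<close>
  define q q' where "q = continuant n (\<lambda>i. a (Suc i))" and "q' = continuant n (\<lambda>i. b (Suc i))"
  have a: "a i > 0" and b: "b i > 0" if "i \<le> n" for i
    using assms(3) that by (auto simp: permutiple_def canonical_cf_def b_def)
  have pos: "p > 0" "p' > 0" "q > 0" "q' > 0"
    unfolding p_def p'_def q_def q'_def using a b by (auto intro!: continuant_pos)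
  have "real_of_int p / of_int q = of_int k * (of_int p' / of_int q')"
    using assms(3) cf_value_eq_continuant_quotient[OF a] cf_value_eq_continuant_quotient[OF b]
    by (simp add: permutiple_def p_def p'_def q_def q'_def flip: b_def)
  then have "real_of_int (p * q') = of_int (k * p' * q)"
    using pos by (simp add: field_simps)
  then have "p * q' = p' * (k * q)"
    by (simp only: of_int_eq_iff ac_simps)
  then have "p' dvd p * q'" by simp
  moreover have "coprime p' q'"
    unfolding p'_def q'_def by (rule coprime_continuant_shift)
  ultimately have "p' dvd p"
    by (simp add: coprime_dvd_mult_left_iff)
  then obtain d where d: "p = p' * d" ..
  have "real_of_int p / of_int p' < 2"
    using assms(4) by (simp add: p_def p'_def b_def)
  with d pos have "d < 2" by simp
  moreover have "d > 0" using d pos by (simp add: zero_less_mult_iff)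
  ultimately have "d = 1" by simp
  with d show ?thesis
    by (simp add: continuant_preserving_def p_def p'_def b_def)
qed

end
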